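(* Let $n,k$ be positive integers, and write $n=mk+j$ with $0\le j\le k-1$. Then for $1\le r\le k$, $$\mathrm{SgnMPDE}_{n,r}^k(t)=\begin{cases}(-1)^n(-t)^k\big([m]_t\big)^j\big([m-1]_t\big)^{k-j} & \text{if } r=1,\\ \mathrm{SgnMPE}_{n,r}^k(t) & \text{if } r\ge 2.\end{cases}$$
   Context: $\mathfrak{S}_n$ is the symmetric group on $[n]=\{1,\dots,n\}$, with $\pi=\pi_1\pi_2\cdots\pi_n$ in one-line notation. $\mathrm{exc}(\pi)=|\{i\in[n-1]:\pi_i>i\}|$ and $\mathrm{inv}(\pi)=|\{(i,j): i<j,\ \pi_i>\pi_j\}|$. A derangement is a permutation $\pi$ with $\pi_i\ne i$ for all $i\in[n]$. For a positive integer $k$ and $1\le r\le k$, $\mathrm{MP}_{n,r}^k$ is the set of $\pi\in\mathfrak{S}_n$ with $\pi_i-i\equiv r-1\pmod k$ for all $1\le i\le n$, and $\mathrm{MPD}_{n,r}^k$ is the set of derangements in $\mathrm{MP}_{n,r}^k$. Define $$\mathrm{SgnMPE}_{n,r}^k(t)=\sum_{\pi\in\mathrm{MP}_{n,r}^k}(-1)^{\mathrm{inv}(\pi)}t^{\mathrm{exc}(\pi)},\qquad \mathrm{SgnMPDE}_{n,r}^k(t)=\sum_{\pi\in\mathrm{MPD}_{n,r}^k}(-1)^{\mathrm{inv}(\pi)}t^{\mathrm{exc}(\pi)}$$ (an empty sum is $0$). For an integer $a$, $[a]_t=\frac{1-t^a}{1-t}$, so $[0]_t=0$ and $[a]_t=1+t+\cdots+t^{a-1}$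 for $a\ge1$; when $m=0$, $[m-1]_t=[-1]_t$ is read as the rational function $\frac{1-t^{-1}}{1-t}=-t^{-1}$. The convention $0^0=1$ is used. *)

theory Defs
  imports
    "HOL-Computational_Algebra.Computational_Algebra"
    "HOL-Combinatorics.Permutations"
    "HOL-Number_Theory.Cong"
begin

text \<open>A permutation of \<open>[n]\<close> is a function \<open>p :: nat \<Rightarrow> nat\<close> with \<open>p permutes {1..n}\<close>;
  it is the identity outside \<open>{1..n}\<close>, so these functions correspond exactly to the elements
  of the symmetric group.\<close>

definition exc :: "nat \<Rightarrow> (nat \<Rightarrow> nat) \<Rightarrow> nat" where
  "exc n p = card {i \<in> {1..n - 1}. p i > i}"

definition inv_count :: "nat \<Rightarrow> (nat \<Rightarrow> nat) \<Rightarrow> nat" where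
  "inv_count n p = card {(i, j). i \<in> {1..n} \<and> j \<in> {1..n} \<and> i < j \<and> p i > p j}"

definition derangement :: "nat \<Rightarrow> (nat \<Rightarrow> nat) \<Rightarrow> bool" where
  "derangement n p \<longleftrightarrow> p permutes {1..n} \<and> (\<forall>i\<in>{1..n}. p i \<noteq> i)"

text \<open>The congruence is stated over the integers, because \<open>p i - i\<close> may be negative.\<close>

definition MP :: "nat \<Rightarrow> nat \<Rightarrow> nat \<Rightarrow> (nat \<Rightarrow> nat) set" where
  "MP k n r = {p. p permutes {1..n} \<and>
     (\<forall>i\<in>{1..n}. [int (p i) - int i = int r - 1] (mod int k))}"

definition MPD :: "nat \<Rightarrow> nat \<Rightarrow> nat \<Rightarrow> (nat \<Rightarrow> nat) set" where
  "MPD k n r = {p \<in> MP k n r. derangement n p}"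

text \<open>The indeterminate \<open>t\<close> is \<open>[:0, 1:]\<close>.\<close>

definition SgnMPE :: "nat \<Rightarrow> nat \<Rightarrow> nat \<Rightarrow> int poly" where
  "SgnMPE k n r = (\<Sum>p\<in>MP k n r. (-1) ^ inv_count n p * [:0, 1:] ^ exc n p)"

definition SgnMPDE :: "nat \<Rightarrow> nat \<Rightarrow> nat \<Rightarrow> int poly" where
  "SgnMPDE k n r = (\<Sum>p\<in>MPD k n r. (-1) ^ inv_count n p * [:0, 1:] ^ exc n p)"

text \<open>Since \<open>[-1]\<^sub>t = -1/t\<close> occurs, the identity is one of rational functions; \<open>tvar\<close> is the
  indeterminate in the field of fractions of the integer polynomials, and \<open>qint a\<close> is \<open>[a]\<^sub>t\<close>
  for an arbitrary integer \<open>a\<close>.\<close>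

definition tvar :: "int poly fract" where
  "tvar = to_fract [:0, 1:]"

definition qint :: "int \<Rightarrow> int poly fract" where
  "qint a = (1 - tvar powi a) / (1 - tvar)"

end

theory Submission
  imports Defs "Jordan_Normal_Form.Determinant"
begin

text \<open>
  For \<open>r \<ge> 2\<close> the required displacement \<open>r - 1\<close> is not divisible by \<open>k\<close>, so no permutation in the
  class has a fixed point and there is nothing to compute.

  For \<open>r = 1\<close>, \<open>(-1) ^ inv\<close> is the sign of the permutation (\<open>minus_one_power_inv_count\<close>), and the
  excedance number is multiplicative over positions. The sum is therefore the determinant of the
  \<open>n \<times> n\<close> matrix \<open>A\<close> whose entry at \<open>(a, b)\<close> vanishes unless \<open>a \<equiv> b (mod k)\<close>, and otherwise is \<open>t\<close>
  above, \<open>1\<close> below and \<open>0\<close> on the diagonal (\<open>SgnMPDE_1_eq_det\<close>).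

  Up to a simultaneous reordering of rows and columns, \<open>A\<close> is block diagonal with one block per
  residue class. Consecutive rows of a block differ in just two adjacent places, where the
  difference is \<open>-1\<close> on the diagonal and \<open>t\<close> immediately to the right. Hence subtracting from each row
  the next one of its class leaves a bidiagonal array above the last row of the block, and adding
  \<open>t\<close> times each column to the next one of its class, from left to right, clears the entries
  \<open>t\<close>. The result is lower triangular. Its diagonal holds \<open>-1\<close> everywhere except in the last row of
  each block, where the column operations have accumulated \<open>t + t\<^sup>2 + \<dots>\<close> with as many terms as the
  block has earlier rows. All classes are treated at once: the two operations are multiplication
  by unitriangular matrices of size \<open>n\<close>, and the last rows of the blocks are the last \<open>k\<close> rows
  (\<open>det_weight\<close>).

  With \<open>n = m * k + j\<close> there are \<open>j\<close> blocks of size \<open>m + 1\<close> and \<open>k - j\<close> blocks of size \<open>m\<close>, which gives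
  the stated product. For \<open>m = 0\<close> some block consists of a single zero, and the
  factor \<open>[0]\<^sub>t ^ j\<close> vanishes as well.
\<close>

section \<open>The parity of the inversion number\<close>

lemma permutes_interval_eq_id_if_no_descent:
  assumes p: "p permutes {1..n}" and asc: "\<And>i. 1 \<le> i \<Longrightarrow> Suc i \<le> n \<Longrightarrow> p i \<le> p (Suc i)"
  shows "p = id"
proof (rule permutes_natset_ge[OF p], rule ballI)
  have less: "p i < p (Suc i)" if "1 \<le> i" "Suc i \<le> n" for i
    using asc[OF that] permutes_inj[OF p] by (metis inj_eq le_neq_implies_less n_not_Suc_n)
  have "1 \<le> i \<Longrightarrow> i \<le> n \<Longrightarrow> i \<le> p i" for i
  proof (induction i)
    case (Suc i)
    show ?case
    proof (cases "i = 0")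
      case True
      with Suc.prems permutes_in_image[OF p, of 1] show ?thesis by simp
    next
      case False
      with Suc less[of i] show ?thesis by simp
    qed
  qed simp
  then show "i \<le> p i" if "i \<in> {1..n}" for i using that by simp
qed

text \<open>The transposition of two adjacent positions keeps every other pair of positions in order. It
  therefore matches the inversions of the sorted permutation with those of \<open>p\<close> other than
  \<open>(i, Suc i)\<close>.\<close>

lemma inv_count_descent:
  assumes p: "p permutes {1..n}" and i: "1 \<le> i" "Suc i \<le> n" and desc: "p (Suc i) < p i"
  shows "inv_count n p = Suc (inv_count n (p \<circ> transpose i (Suc i)))"
proof -
  define \<tau> where "\<tau> = transpose i (Suc i)"
  define I where "I q = {(a, b). a \<in> {1..n} \<and> b \<in> {1..n} \<and> a < b \<and> q a > q b}"
    for q :: "nat \<Rightarrow> nat"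
  have fin: "finite (I q)" for q
    by (rule finite_subset[of _ "{1..n} \<times> {1..n}"]) (auto simp: I_def)
  have \<tau>\<tau>: "\<tau> (\<tau> x) = x" for x by (simp add: \<tau>_def)
  have \<tau>_in: "\<tau> x \<in> {1..n} \<longleftrightarrow> x \<in> {1..n}" for x
    using i by (auto simp: \<tau>_def transpose_def)
  have mono: "\<tau> a < \<tau> b" if "a < b" "(a, b) \<noteq> (i, Suc i)" for a b
    using that by (auto simp: \<tau>_def transpose_def)
  have "bij_betw (map_prod \<tau> \<tau>) (I (p \<circ> \<tau>)) (I p - {(i, Suc i)})"
  proof (rule bij_betw_byWitness[where f' = "map_prod \<tau> \<tau>"])
    show "map_prod \<tau> \<tau> ` I (p \<circ> \<tau>) \<subseteq> I p - {(i, Suc i)}"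
    proof
      fix x assume "x \<in> map_prod \<tau> \<tau> ` I (p \<circ> \<tau>)"
      then obtain a b where x: "x = (\<tau> a, \<tau> b)" and ab: "(a, b) \<in> I (p \<circ> \<tau>)" by auto
      have "(a, b) \<noteq> (i, Suc i)" using ab desc by (auto simp: I_def \<tau>_def)
      moreover have "(\<tau> a, \<tau> b) \<noteq> (i, Suc i)"
      proof
        assume "(\<tau> a, \<tau> b) = (i, Suc i)"
        then have "a = \<tau> i" "b = \<tau> (Suc i)" by (metis \<tau>\<tau> prod.inject)+
        then show False using ab by (simp add: I_def \<tau>_def)
      qed
      ultimately show "x \<in> I p - {(i, Suc i)}"
        using x ab mono[of a b] \<tau>_in[of a] \<tau>_in[of b] by (auto simp: I_def)
    qed
    show "map_prod \<tau> \<tau> ` (I p - {(i, Suc i)}) \<subseteq> I (p \<circ> \<tau>)"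
    proof
      fix x assume "x \<in> map_prod \<tau> \<tau> ` (I p - {(i, Suc i)})"
      then obtain a b where "x = (\<tau> a, \<tau> b)" "(a, b) \<in> I p" "(a, b) \<noteq> (i, Suc i)" by auto
      then show "x \<in> I (p \<circ> \<tau>)"
        using mono[of a b] \<tau>_in[of a] \<tau>_in[of b] by (auto simp: I_def \<tau>\<tau>)
    qed
  qed (auto simp: \<tau>\<tau>)
  then have "card (I (p \<circ> \<tau>)) = card (I p - {(i, Suc i)})" by (rule bij_betw_same_card)
  moreover have "(i, Suc i) \<in> I p" using i desc by (simp add: I_def)
  ultimately have "card (I p) = Suc (card (I (p \<circ> \<tau>)))"
    using fin[of p] by (metis card.remove)
  then show ?thesis by (simp add: inv_count_def I_def \<tau>_def)
qed

text \<open>Each exchange at an adjacent descent changes both sides by the factor \<open>-1\<close>, and repeated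
  exchanges lower the inversion number until the identity is reached.\<close>

lemma minus_one_power_inv_count:
  assumes "p permutes {1..n}"
  shows "(-1) ^ inv_count n p = sign p"
  using assms
proof (induction "inv_count n p" arbitrary: p rule: less_induct)
  case less
  show ?case
  proof (cases "\<exists>i. 1 \<le> i \<and> Suc i \<le> n \<and> p (Suc i) < p i")
    case True
    then obtain i where i: "1 \<le> i" "Suc i \<le> n" "p (Suc i) < p i" by blast
    let ?\<tau> = "transpose i (Suc i)"
    have \<tau>: "?\<tau> permutes {1..n}" using i by (intro permutes_swap_id) auto
    have perm: "permutation p" "permutation ?\<tau>"
      using less.prems \<tau> by (blast intro: permutes_imp_permutation finite_atLeastAtMost)+
    note inv = inv_count_descent[OF less.prems i]
    have "(-1) ^ inv_count n (p \<circ> ?\<tau>) = sign (p \<circ> ?\<tau>)"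
      using inv by (intro less.hyps permutes_compose[OF \<tau> less.prems]) simp
    with inv show ?thesis
      by (simp add: sign_compose[OF perm] sign_swap_id)
  next
    case False
    then have "p = id"
      by (intro permutes_interval_eq_id_if_no_descent[OF less.prems]) (meson not_less)
    moreover have "{(i, j). i \<in> {1..n} \<and> j \<in> {1..n} \<and> i < j \<and> id i > id j} = {}" by auto
    then have "inv_count n id = 0" unfolding inv_count_def by (simp only: card.empty)
    ultimately show ?thesis by simp
  qed
qed

section \<open>The signed excedance sum as a determinant\<close>

definition weight :: "'a::comm_ring_1 \<Rightarrow> nat \<Rightarrow> nat \<Rightarrow> nat \<Rightarrow> 'a" where
  "weight t k a b =
    (if a mod k = b mod k then if a < b then t else if b < a then 1 else 0 else 0)"

text \<open>Only the relative position of row and column matters. This allows passing from the positions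
  \<open>1, \<dots>, n\<close> of a permutation to the matrix indices \<open>0, \<dots>, n - 1\<close>.\<close>

lemma weight_Suc: "weight t k (Suc a) (Suc b) = weight t k a b"
proof -
  have "Suc a mod k = Suc b mod k \<longleftrightarrow> a mod k = b mod k"
    using cong_add_rcancel_nat[of a 1 b k] by (simp add: cong_def)
  then show ?thesis by (simp add: weight_def)
qed

lemma MPD_1_iff:
  "p \<in> MPD k n (Suc 0) \<longleftrightarrow>
    p permutes {1..n} \<and> (\<forall>i\<in>{1..n}. i mod k = p i mod k \<and> p i \<noteq> i)"
proof -
  have "[int (p i) - int i = int 1 - 1] (mod int k) \<longleftrightarrow> i mod k = p i mod k" for i
    by (simp add: cong_diff_iff_cong_0 cong_int_iff)
      (auto simp: cong_def)
  then show ?thesis by (auto simp: MPD_def MP_def derangement_def)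
qed

text \<open>The zeros of the weight exclude exactly the permutations with a fixed point or with a
  displacement not divisible by \<open>k\<close>; every surviving one picks up a factor \<open>t\<close> at each
  excedance.\<close>

lemma prod_weight:
  assumes p: "p permutes {1..n}"
  shows "(\<Prod>i\<in>{1..n}. weight t k i (p i)) = (if p \<in> MPD k n 1 then t ^ exc n p else 0)"
proof (cases "p \<in> MPD k n 1")
  case True
  have "(\<Prod>i\<in>{1..n}. weight t k i (p i)) = (\<Prod>i\<in>{1..n}. if i < p i then t else 1)"
  proof (rule prod.cong)
    fix i assume "i \<in> {1..n}"
    then have "i mod k = p i mod k" "p i \<noteq> i" using True by (simp_all add: MPD_1_iff)
    then show "weight t k i (p i) = (if i < p i then t else 1)" by (simp add: weight_def)
  qed simp
  also have "\<dots> = t ^ card {i \<in> {1..n}. i < p i}"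
    by (simp add: prod.If_cases Int_def)
  \<comment> \<open>Position \<open>n\<close> is never an excedance.\<close>
  also have "{i \<in> {1..n}. i < p i} = {i \<in> {1..n - 1}. i < p i}"
  proof -
    have "p i \<le> n" if "i \<in> {1..n}" for i using permutes_in_image[OF p] that by fastforce
    then have "i \<le> n - 1" if "i \<in> {1..n}" "i < p i" for i using that by fastforce
    then show ?thesis by auto
  qed
  finally show ?thesis using True by (simp add: exc_def)
next
  case False
  then obtain i where "i \<in> {1..n}" "i mod k \<noteq> p i mod k \<or> p i = i"
    using p by (auto simp: MPD_1_iff)
  then have "i \<in> {1..n}" "weight t k i (p i) = 0" by (auto simp: weight_def)
  then have "(\<Prod>i\<in>{1..n}. weight t k i (p i)) = 0" by (intro prod_zero) auto
  then show ?thesis using False by simp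
qed

lemma det_mat_Suc:
  "det (mat n n (\<lambda>(i, j). f (Suc i) (Suc j))) =
    (\<Sum>p | p permutes {1..n}. of_int (sign p) * (\<Prod>i\<in>{1..n}. f i (p i)))"
proof -
  have bij: "bij_betw Suc {0..<n} {1..n}"
    by (rule bij_betwI[where g = "\<lambda>x. x - 1"]) auto
  have bij': "bij_betw (\<lambda>x. x - 1) {1..n} {0..<n}"
    by (rule bij_betwI[where g = Suc]) auto
  let ?F = "map_permutation {0..<n} Suc" and ?G = "map_permutation {1..n} (\<lambda>x. x - 1)"
  have "(\<Sum>p | p permutes {0..<n}. signof p *
          (\<Prod>i = 0..<n. mat n n (\<lambda>(i, j). f (Suc i) (Suc j)) $$ (i, p i))) =
        (\<Sum>p | p permutes {1..n}. of_int (sign p) * (\<Prod>i\<in>{1..n}. f i (p i)))"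
  proof (rule sum.reindex_bij_witness[where i = ?G and j = ?F]; clarify)
    fix p assume p: "p permutes {0..<n}"
    show "?G (?F p) = p"
      by (rule map_permutation_compose_inv[OF bij p]) simp
    show "?F p permutes {1..n}" by (rule map_permutation_permutes[OF bij p])
    have "sign (?F p) = sign p" by (rule sign_map_permutation[OF _ p]) auto
    moreover have "(\<Prod>i\<in>{1..n}. f i (?F p i)) = (\<Prod>i = 0..<n. f (Suc i) (?F p (Suc i)))"
      by (rule prod.reindex_bij_betw[OF bij, symmetric])
    moreover have "?F p (Suc i) = Suc (p i)" if "i \<in> {0..<n}" for i
      by (rule map_permutation_apply) (use that in auto)
    moreover have "p i < n" if "i < n" for i
      using permutes_in_image[OF p, of i] that by simp
    ultimately show "of_int (sign (?F p)) * (\<Prod>i\<in>{1..n}. f i (?F p i)) =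
        signof p * (\<Prod>i = 0..<n. mat n n (\<lambda>(i, j). f (Suc i) (Suc j)) $$ (i, p i))"
      by simp
  next
    fix p assume p: "p permutes {1..n}"
    show "?F (?G p) = p"
      by (rule map_permutation_compose_inv[OF bij' p]) auto
    show "?G p permutes {0..<n}" by (rule map_permutation_permutes[OF bij' p])
  qed
  then show ?thesis by (simp add: det_def)
qed

lemma SgnMPDE_1_eq_det:
  "SgnMPDE k n 1 = det (mat n n (\<lambda>(i, j). weight [:0, 1:] k i j))"
proof -
  have "SgnMPDE k n 1 =
      (\<Sum>p | p permutes {1..n}. of_int (sign p) * (\<Prod>i\<in>{1..n}. weight [:0, 1:] k i (p i)))"
    unfolding SgnMPDE_def
  proof (rule sum.mono_neutral_cong_left)
    show "finite {p. p permutes {1..n}}" by (rule finite_permutations) simp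
    show "MPD k n 1 \<subseteq> {p. p permutes {1..n}}" by (auto simp: MPD_1_iff)
    fix p assume p: "p \<in> MPD k n 1"
    then have perm: "p permutes {1..n}" by (simp add: MPD_1_iff)
    have "(-1 :: int poly) ^ inv_count n p = of_int ((-1) ^ inv_count n p)" by simp
    also have "\<dots> = of_int (sign p)" by (simp only: minus_one_power_inv_count[OF perm])
    finally show "(-1) ^ inv_count n p * ([:0, 1:] :: int poly) ^ exc n p =
        of_int (sign p) * (\<Prod>i\<in>{1..n}. weight [:0, 1:] k i (p i))"
      by (simp only: prod_weight[OF perm] p if_True)
  next
    show "\<forall>p\<in>{p. p permutes {1..n}} - MPD k n 1.
        of_int (sign p) * (\<Prod>i\<in>{1..n}. weight ([:0, 1:] :: int poly) k i (p i)) = 0"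
    proof
      fix p assume "p \<in> {p. p permutes {1..n}} - MPD k n 1"
      then have "p permutes {1..n}" "p \<notin> MPD k n 1" by simp_all
      then show "of_int (sign p) * (\<Prod>i\<in>{1..n}. weight ([:0, 1:] :: int poly) k i (p i)) = 0"
        by (simp only: prod_weight if_False mult_zero_right)
    qed
  qed
  also have "\<dots> = det (mat n n (\<lambda>(i, j). weight [:0, 1:] k (Suc i) (Suc j)))"
    by (rule det_mat_Suc[symmetric])
  finally show ?thesis by (simp add: weight_Suc)
qed

section \<open>Evaluation of the determinant\<close>

lemma det_triangular_unit:
  fixes A :: "'a::comm_ring_1 mat"
  assumes "A \<in> carrier_mat n n" "upper_triangular A" "\<And>i. i < n \<Longrightarrow> A $$ (i, i) = 1"
  shows "det A = 1"
proof -
  have "det A = (\<Prod>i = 0..<n. A $$ (i, i))"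
    using det_upper_triangular[OF assms(2,1)] assms(1) by (simp add: prod_list_diag_prod)
  then show ?thesis using assms(3) by simp
qed

lemma mod_eq_less_imp_add_le:
  fixes i b k :: nat
  assumes "i mod k = b mod k" "i < b"
  shows "i + k \<le> b"
proof -
  have "k dvd b - i" using assms mod_eq_dvd_iff_nat[of i b k] by simp
  with assms(2) have "k \<le> b - i" by (simp add: dvd_imp_le)
  with assms(2) show ?thesis by simp
qed

lemma mat_mult_entry:
  assumes "i < n" "j < n"
  shows "(mat n n f * mat n n g) $$ (i, j) = (\<Sum>c = 0..<n. f (i, c) * g (c, j))"
  using assms by (simp add: scalar_prod_def)

text \<open>With \<open>A\<close> the weight matrix, left multiplication by \<open>P\<close> subtracts row \<open>i + k\<close> from row \<open>i\<close>. Right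
  multiplication by \<open>Q\<close> performs the column operations that clear the remaining entries \<open>t\<close>; \<open>Q\<close> has
  the powers of \<open>t\<close> of a geometric series above the diagonal because these operations are carried
  out successively along a residue class. Both have determinant \<open>1\<close>, and \<open>P * A * Q\<close> is lower
  triangular.\<close>

lemma det_weight:
  fixes t :: "'a::comm_ring_1"
  assumes k: "1 \<le> k" and kn: "k \<le> n"
  shows "det (mat n n (\<lambda>(i, j). weight t k i j)) =
    (-1) ^ (n - k) * (\<Prod>i = n - k..<n. \<Sum>a = 1..i div k. t ^ a)"
proof -
  define A where "A = mat n n (\<lambda>(i, j). weight t k i j)"
  define P :: "'a mat" where
    "P = mat n n (\<lambda>(i, c). if c = i then 1 else if c = i + k then -1 else 0)"
  define q :: "nat \<Rightarrow> nat \<Rightarrow> 'a" where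
    "q c b = (if c \<le> b \<and> c mod k = b mod k then t ^ ((b - c) div k) else 0)" for c b
  define Q where "Q = mat n n (\<lambda>(c, b). q c b)"
  have carrier: "A \<in> carrier_mat n n" "P \<in> carrier_mat n n" "Q \<in> carrier_mat n n"
    by (simp_all add: A_def P_def Q_def)
  have "det P = 1" using carrier(2) k
    by (intro det_triangular_unit) (auto simp: P_def)
  moreover have "det Q = 1" using carrier(3)
    by (intro det_triangular_unit) (auto simp: Q_def q_def)
  ultimately have det_eq: "det A = det (P * A * Q)"
    using carrier by (simp add: det_mult[of _ n])
  \<comment> \<open>The entries of \<open>P * A\<close>: the rows with a successor in their class become bidiagonal.\<close>
  define d where "d i c = (if i + k < n then if c = i then -1 else if c = i + k then t else 0
      else weight t k i c)" for i c
  have PA: "P * A = mat n n (\<lambda>(i, c). d i c)"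
  proof (rule eq_matI)
    fix i c assume "i < dim_row (mat n n (\<lambda>(i, c). d i c))"
      "c < dim_col (mat n n (\<lambda>(i, c). d i c))"
    then have ic: "i < n" "c < n" by simp_all
    have "(P * A) $$ (i, c) = (\<Sum>l = 0..<n.
        (if l = i then 1 else if l = i + k then -1 else 0) * weight t k l c)"
      unfolding P_def A_def mat_mult_entry[OF ic] by simp
    also have "\<dots> = (\<Sum>l = 0..<n. (if l = i then weight t k l c else 0) -
        (if l = i + k then weight t k l c else 0))"
      using k by (intro sum.cong) auto
    also have "\<dots> = weight t k i c - (if i + k < n then weight t k (i + k) c else 0)"
      using ic by (simp add: sum_subtractf)
    also have "\<dots> = d i c"
      using k mod_eq_less_imp_add_le[of i k c] by (auto simp: d_def weight_def)
    finally show "(P * A) $$ (i, c) = mat n n (\<lambda>(i, c). d i c) $$ (i, c)" using ic by simp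
  qed (simp_all add: P_def A_def)
  have entry: "(P * A * Q) $$ (i, b) = (\<Sum>c = 0..<n. d i c * q c b)" if "i < n" "b < n" for i b
    unfolding PA Q_def mat_mult_entry[OF that] by simp
  have upper: "(P * A * Q) $$ (i, b) = (if b = i then -1 else 0)"
    if i: "i + k < n" and b: "b < n" for i b
  proof -
    have "(P * A * Q) $$ (i, b) = (\<Sum>c = 0..<n. (if c = i then - q c b else 0) +
        (if c = i + k then t * q c b else 0))"
      unfolding entry[OF add_lessD1[OF i] b] using i k
      by (intro sum.cong) (auto simp: d_def)
    also have "\<dots> = t * q (i + k) b - q i b"
      using i by (simp add: sum.distrib)
    also have "\<dots> = (if b = i then -1 else 0)"
    proof (cases "i mod k = b mod k \<and> i < b")
      case True
      then have le: "i + k \<le> b" by (intro mod_eq_less_imp_add_le) auto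
      then have "(b - i) div k = Suc ((b - (i + k)) div k)"
        using k le_div_geq[of k "b - i"] by simp
      then show ?thesis using True le by (simp add: q_def)
    next
      case False
      then show ?thesis using k by (auto simp: q_def)
    qed
    finally show ?thesis .
  qed
  \<comment> \<open>In the last row \<open>i\<close> of a class every other index of the class is smaller, so the weight
    is \<open>1\<close> there and the value \<open>t\<close> does not occur.\<close>
  have last: "d i c * q c b = (if c < i \<and> c mod k = i mod k then q c b else 0)"
    if i: "n \<le> i + k" and "i < n" "b < n" "c < n" "i \<le> b" for i b c
    using that mod_eq_less_imp_add_le[of i k c] by (auto simp: d_def weight_def)
  have diag: "(P * A * Q) $$ (i, i) = (\<Sum>a = 1..i div k. t ^ a)" if i: "n \<le> i + k" "i < n" for i
  proof -
    have "(P * A * Q) $$ (i, i) = (\<Sum>c = 0..<n. if c < i \<and> c mod k = i mod k then q c i else 0)"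
      unfolding entry[OF i(2) i(2)] using i by (intro sum.cong last) auto
    also have "\<dots> = (\<Sum>c | c < i \<and> c mod k = i mod k. q c i)"
      using i by (intro sum.mono_neutral_cong_right) auto
    also have "\<dots> = (\<Sum>a = 1..i div k. t ^ a)"
    proof (rule sum.reindex_bij_witness[where i = "\<lambda>a. i - a * k" and j = "\<lambda>c. (i - c) div k"])
      fix c assume "c \<in> {c. c < i \<and> c mod k = i mod k}"
      then have c: "c < i" "c mod k = i mod k" by auto
      then have "k dvd i - c" using mod_eq_dvd_iff_nat[of c i k] by simp
      then obtain a where a: "i - c = k * a" by (elim dvdE)
      then have i_eq: "i = c + k * a" using c by simp
      show "i - (i - c) div k * k = c" using a k c by (simp add: mult.commute)
      have "a \<noteq> 0" using a c by (intro notI) simp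
      then show "(i - c) div k \<in> {1..i div k}" using a k i_eq by simp
      show "t ^ ((i - c) div k) = q c i" using c by (simp add: q_def)
    next
      fix a assume a: "a \<in> {1..i div k}"
      then have "a * k \<le> i div k * k" by simp
      then have le: "a * k \<le> i" using div_times_less_eq_dividend order_trans by blast
      then show "(i - (i - a * k)) div k = a" using k by simp
      have "0 < a * k" using a k by simp
      with le have "i - a * k < i" by linarith
      moreover have "(i - a * k) mod k = i mod k"
        using le by (metis le_add_diff_inverse2 mod_mult_self1)
      ultimately show "i - a * k \<in> {c. c < i \<and> c mod k = i mod k}"  by simp
    qed
    finally show ?thesis .
  qed
  have zero: "(P * A * Q) $$ (i, b) = 0" if "i < b" "b < n" for i b
  proof (cases "i + k < n")
    case True
    then show ?thesis using upper that by simp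
  next
    case False
    have "d i c * q c b = 0" if "c < n" for c
      using last[of i b c] mod_eq_less_imp_add_le[of i k b] False that \<open>i < b\<close> \<open>b < n\<close>
      by (auto simp: q_def)
    then show ?thesis using entry[of i b] that by simp
  qed
  have "det (P * A * Q) = (\<Prod>i = 0..<n. (P * A * Q) $$ (i, i))"
    using carrier zero by (subst det_lower_triangular[of n])
      (auto simp: prod_list_diag_prod)
  also have "\<dots> = (\<Prod>i = 0..<n - k. (P * A * Q) $$ (i, i)) *
      (\<Prod>i = n - k..<n. (P * A * Q) $$ (i, i))"
    by (rule prod.atLeastLessThan_concat[symmetric]) auto
  also have "(\<Prod>i = 0..<n - k. (P * A * Q) $$ (i, i)) = (\<Prod>i = 0..<n - k. -1)"
    by (rule prod.cong) (auto simp: upper)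
  also have "(\<Prod>i = n - k..<n. (P * A * Q) $$ (i, i)) =
      (\<Prod>i = n - k..<n. \<Sum>a = 1..i div k. t ^ a)"
    by (rule prod.cong) (auto simp: diag)
  finally show ?thesis using det_eq by (simp add: A_def)
qed

section \<open>Derangements in a fixed displacement class\<close>

lemma to_fract_prod: "to_fract (\<Prod>x\<in>A. f x) = (\<Prod>x\<in>A. to_fract (f x))"
  by (induction A rule: infinite_finite_induct) simp_all

lemma to_fract_power: "to_fract (x ^ n) = to_fract x ^ n"
  by (induction n) simp_all

lemma to_fract_geometric_sum:
  "to_fract (\<Sum>a = 1..d. [:0, 1:] ^ a) = tvar * qint (int d)"
proof -
  have ne: "1 - tvar \<noteq> 0"
    by (simp add: tvar_def flip: to_fract_1) (simp add: one_pCons)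
  have "(1 - tvar) * (\<Sum>a = 1..d. tvar ^ a) = tvar * (1 - tvar ^ d)"
  proof (induction d)
    case (Suc d)
    have "(1 - tvar) * (\<Sum>a = 1..Suc d. tvar ^ a) =
        (1 - tvar) * (\<Sum>a = 1..d. tvar ^ a) + (1 - tvar) * tvar ^ Suc d"
      by (simp add: distrib_left)
    also have "\<dots> = tvar * (1 - tvar ^ Suc d)"
      unfolding Suc.IH by (simp add: algebra_simps)
    finally show ?case .
  qed simp
  moreover have "to_fract (\<Sum>a = 1..d. [:0, 1:] ^ a) = (\<Sum>a = 1..d. tvar ^ a)"
    by (simp add: to_fract_power tvar_def)
  ultimately show ?thesis using ne by (simp add: qint_def field_simps)
qed

lemma MPD_eq_MP:
  assumes "2 \<le> r" "r \<le> k"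
  shows "MPD k n r = MP k n r"
proof -
  have "p i \<noteq> i" if "[int (p i) - int i = int r - 1] (mod int k)" for p :: "nat \<Rightarrow> nat" and i
  proof
    assume "p i = i"
    with that have "int k dvd int r - 1" by (simp add: cong_def mod_eq_0_iff_dvd)
    then have "int k \<le> int r - 1" using assms by (intro zdvd_imp_le) auto
    then show False using assms by simp
  qed
  then show ?thesis by (auto simp: MPD_def MP_def derangement_def)
qed

text \<open>The residue class of \<open>1\<close> has no second element, so position \<open>1\<close> is fixed.\<close>

lemma MPD_1_empty:
  assumes "1 \<le> n" "n < k"
  shows "MPD k n 1 = {}"
proof -
  have "p 1 = 1" if "p permutes {1..n}" "1 mod k = p 1 mod k" for p
    using permutes_in_image[OF that(1), of 1] that(2) assms by simp
  moreover have "p permutes {1..n}" "1 mod k = p 1 mod k" "p 1 \<noteq> 1" if "p \<in> MPD k n 1" for p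
    using that assms(1) MPD_1_iff[of p k n] by (auto dest: bspec[of _ _ 1])
  ultimately show ?thesis by blast
qed

lemma SgnMPDE_1:
  assumes n: "n = m * k + j" "1 \<le> n" and k: "1 \<le> k" "j \<le> k - 1"
  shows "to_fract (SgnMPDE k n 1) =
    (-1) ^ n * (- tvar) ^ k * qint (int m) ^ j * qint (int m - 1) ^ (k - j)"
proof (cases "m = 0")
  case True
  then have "MPD k n 1 = {}" using n k by (intro MPD_1_empty) auto
  moreover have "qint 0 ^ j = 0" using True n by (simp add: qint_def)
  ultimately show ?thesis using True by (simp add: SgnMPDE_def)
next
  case False
  then obtain m' where m: "m = Suc m'" by (cases m) auto
  have kn: "k \<le> n" using n m by simp
  define f where "f i = tvar * qint (int (i div k))" for i
  have "to_fract (SgnMPDE k n 1) = (-1) ^ (n - k) * (\<Prod>i = n - k..<n. f i)"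
    unfolding SgnMPDE_1_eq_det det_weight[OF k(1) kn] f_def
      to_fract_mult to_fract_prod to_fract_power to_fract_geometric_sum by simp
  \<comment> \<open>Among the last \<open>k\<close> indices, the \<open>k - j\<close> ones below \<open>m * k\<close> end the classes of size \<open>m\<close>, and the
    other \<open>j\<close> end those of size \<open>m + 1\<close>.\<close>
  also have "(\<Prod>i = n - k..<n. f i) = (\<Prod>i = n - k..<m * k. f i) * (\<Prod>i = m * k..<n. f i)"
    using n k by (intro prod.atLeastLessThan_concat[symmetric]) auto
  also have "(\<Prod>i = n - k..<m * k. f i) = (\<Prod>i = n - k..<m * k. tvar * qint (int m - 1))"
  proof (rule prod.cong)
    fix i assume i: "i \<in> {n - k..<m * k}"
    then have "i div k = m'" using n k m by (intro div_nat_eqI) (auto simp: mult.commute)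
    then show "f i = tvar * qint (int m - 1)" by (simp add: f_def m)
  qed simp
  also have "\<dots> = (tvar * qint (int m - 1)) ^ (k - j)" using n k m by simp
  also have "(\<Prod>i = m * k..<n. f i) = (\<Prod>i = m * k..<n. tvar * qint (int m))"
  proof (rule prod.cong)
    fix i assume i: "i \<in> {m * k..<n}"
    then have "i div k = m" using n k by (intro div_nat_eqI) (auto simp: mult.commute)
    then show "f i = tvar * qint (int m)" by (simp add: f_def)
  qed simp
  also have "\<dots> = (tvar * qint (int m)) ^ j" using n by simp
  also have "(tvar * qint (int m - 1)) ^ (k - j) * (tvar * qint (int m)) ^ j =
      tvar ^ (k - j + j) * (qint (int m) ^ j * qint (int m - 1) ^ (k - j))"
    by (simp add: power_mult_distrib power_add mult_ac)
  also have "k - j + j = k" using k by simp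
  also have "(-1) ^ (n - k) * (tvar ^ k * (qint (int m) ^ j * qint (int m - 1) ^ (k - j))) =
      (-1) ^ n * (- tvar) ^ k * qint (int m) ^ j * qint (int m - 1) ^ (k - j)"
  proof -
    have "(-1 :: int poly fract) ^ n * (-1) ^ k = (-1) ^ (n - k + 2 * k)"
      using kn by (simp add: add.commute flip: power_add)
    also have "\<dots> = (-1) ^ (n - k)" by (simp add: power_add power_mult)
    finally show ?thesis by (simp add: power_minus[of tvar] mult_ac)
  qed
  finally show ?thesis .
qed

theorem theorem1p5:
  fixes n k m j r :: nat
  assumes "n \<ge> 1" and "k \<ge> 1"
    and "n = m * k + j" and "j \<le> k - 1"
    and "1 \<le> r" and "r \<le> k"
  shows "to_fract (SgnMPDE k n r) =
    (if r = 1
     then (-1) ^ n * (- tvar) ^ k * qint (int m) ^ j * qint (int m - 1) ^ (k - j)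
     else to_fract (SgnMPE k n r))"
proof (cases "r = 1")
  case True
  with SgnMPDE_1[OF assms(3,1,2,4)] show ?thesis by (simp only: simp_thms if_True)
next
  case False
  with assms have "MPD k n r = MP k n r" by (intro MPD_eq_MP) auto
  with False show ?thesis by (simp add: SgnMPDE_def SgnMPE_def)
qed

end
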